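(* Let $C=(x_1,\dots,x_r)$ be a collection of positions, i.e. $r\ge 1$ and $0\le x_1<x_2<\dots<x_r$ are integers. For an integer $n>x_r$ let $V[x_1,\dots,x_r;n]$ be the $(0,1)$-string of length $n$ whose units are exactly at positions $x_1,\dots,x_r$. Then: (i) the string $V[x_1,\dots,x_r;n]$ is irreversible (on a cylinder of size $n$) if and only if $n$ is a multiple of the length of a period of some non-zero solution to the recursion defined by $C$; (ii) if $V[x_1,\dots,x_r;n]$ is irreversible, then $n$ is a multiple of a positive integer not exceeding $2^{x_r-x_1}-1$; (iii) if $r=1$, then the string $V[x_1;n]$ is reversible for every $n>x_1$; (iv) if $r$ is even, then $V[x_1,\dots,x_r;n]$ is irreversible for every $n>x_r$.
   Context: Strings of length $n$ have positions $0,\dots,n-1$ and entries in $\{0,1\}$ (arithmetic on entries is modulo 2, positions are taken modulo $n$). The convolution of strings $V,W$ of length $n$ is $[V\boxtimes W](j)=\sum_{s=0}^{n-1}V(s)W(j-s) \pmod 2$. The identity for $\boxtimes$ is $(1,0,\dots,0)$. A string $V$ of length $n$ is reversible (on a cylinder of size $n$) if it is invertible with respect to $\boxtimes$, and irreversible otherwise. A solution to the recursion defined by $C=(x_1,\dots,x_r)$ is an infinite $(0,1)$-sequence $T=(T(0),T(1),\dots)$ such that, with $\delta=x_r-x_1$, $T(i)=\sum_{l=2}^{r}T(i-(x_l-x_1)) \pmod 2$ for all $i\ge\delta$ (the first $\delta$ symbols of $T$ are arbitrary; an empty sum is $0$). Every solution is eventually periodic; a period of $T$ is a non-empty finite word $\pi$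 such that $T=\rho\,\pi\pi\pi\cdots$ for some finite (possibly empty) word $\rho$ (the pre-period). *)

theory Defs
  imports "HOL-Library.Z2"
begin

text \<open>
  Strings over $\{0,1\}$ are lists over the two-element field \<^typ>\<open>bit\<close>; the size of the
  cylinder on which a string lives is its length.
\<close>

text \<open>
  The index $j - s$ modulo $n$ is written as $(j + n - s)$ modulo $n$, where $s < n$,
  to avoid truncated subtraction on \<^typ>\<open>nat\<close>.
  The operation is only meant for two strings of equal length $n$.
\<close>

definition convolution :: "bit list \<Rightarrow> bit list \<Rightarrow> bit list" (infixl "\<boxtimes>" 70) where
  "V \<boxtimes> W =
     (let n = length V in map (\<lambda>j. \<Sum>s<n. V ! s * W ! ((j + n - s) mod n)) [0..<n])"

definition identity_string :: "nat \<Rightarrow> bit list" where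
  "identity_string n = map (\<lambda>j. if j = 0 then 1 else 0) [0..<n]"

definition reversible :: "bit list \<Rightarrow> bool" where
  "reversible V \<longleftrightarrow>
     (\<exists>W. length W = length V
        \<and> V \<boxtimes> W = identity_string (length V) \<and> W \<boxtimes> V = identity_string (length V))"

abbreviation irreversible :: "bit list \<Rightarrow> bool" where
  "irreversible V \<equiv> \<not> reversible V"

text \<open>
  A collection of positions $(x_1,\dots,x_r)$ is a non-empty, strictly increasing list \<open>C\<close>.
  Lists are indexed from $0$, so $x_l$ is \<open>C ! (l - 1)\<close>; in particular
  $x_1$ is \<open>hd C\<close>, $x_r$ is \<open>last C\<close> and $r$ is \<open>length C\<close>.
\<close>

definition positions :: "nat list \<Rightarrow> bool" where
  "positions C \<longleftrightarrow> C \<noteq> [] \<and> sorted_wrt (<) C"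

definition string_of_positions :: "nat list \<Rightarrow> nat \<Rightarrow> bit list" where
  "string_of_positions C n = map (\<lambda>i. if i \<in> set C then 1 else 0) [0..<n]"

definition solution :: "nat list \<Rightarrow> (nat \<Rightarrow> bit) \<Rightarrow> bool" where
  "solution C T \<longleftrightarrow>
     (\<forall>i \<ge> last C - hd C. T i = (\<Sum>l = 2..length C. T (i - (C ! (l - 1) - hd C))))"

text \<open>The word \<open>p\<close> is a period of \<open>T\<close> if $T = \rho\, p\, p\, p \cdots$ for some word $\rho$.\<close>

definition is_period :: "bit list \<Rightarrow> (nat \<Rightarrow> bit) \<Rightarrow> bool" where
  "is_period p T \<longleftrightarrow>
     p \<noteq> [] \<and>
     (\<exists>\<rho>. \<forall>i. T i = (if i < length \<rho> then \<rho> ! i else p ! ((i - length \<rho>) mod length p)))"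

end

theory Submission
  imports Defs
begin

text \<open>
  A string is irreversible iff convolution with it has a non-zero kernel. Extending a kernel
  element $n$-periodically turns the convolution equation into the recursion, so kernel elements
  correspond to $n$-periodic solutions. Since the recursion also runs backwards, a solution that
  is eventually $n$-periodic is $n$-periodic from the start. For even $r$ the constant sequence 1
  is a solution.
\<close>

text \<open>The default rewriting of \<^typ>\<open>bit\<close> arithmetic to logical connectives breaks ring reasoning.\<close>

declare add_bit_eq_xor [simp del] mult_bit_eq_and [simp del] minus_bit_def [simp del]

lemma UNIV_bit: "UNIV = {0, 1 :: bit}"
  by (auto intro: bit.exhaust)

section \<open>Cyclic convolution\<close>

lemma length_convolution [simp]: "length (V \<boxtimes> W) = length V"
  by (simp add: convolution_def Let_def)

lemma nth_convolution:
  assumes "j < length V"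
  shows "(V \<boxtimes> W) ! j = (\<Sum>s<length V. V ! s * W ! ((j + length V - s) mod length V))"
  using assms by (simp add: convolution_def Let_def)

text \<open>The arguments differ by \<open>(a div n) * n\<close>; \<open>s \<le> n\<close> keeps
  both subtractions from truncating.\<close>

lemma mod_diff_mod_nat:
  fixes a s n :: nat
  assumes "s \<le> n"
  shows "(a mod n + n - s) mod n = (a + n - s) mod n"
proof -
  have "a + n - s = (a mod n + n - s) + (a div n) * n"
    using assms div_mult_mod_eq[of a n] by linarith
  then show ?thesis by simp
qed

text \<open>Sending \<open>s\<close> to j - s is an involution on residues, which is the reindexing
  behind commutativity.\<close>

lemma mod_reflect_nat:
  fixes j s n :: nat
  assumes "j < n" "s < n"
  shows "(j + n - (j + n - s) mod n) mod n = s"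
proof (cases "s \<le> j")
  case True
  then have "(j + n - s) mod n = j - s"
    using assms by (simp add: mod_if)
  then show ?thesis using True assms by simp
next
  case False
  then have "(j + n - s) mod n = j + n - s"
    using assms by simp
  then show ?thesis using False assms by simp
qed

lemma convolution_commute:
  assumes "length V = length W"
  shows "V \<boxtimes> W = W \<boxtimes> V"
proof (rule nth_equalityI)
  fix j assume "j < length (V \<boxtimes> W)"
  then have j: "j < length W" using assms by simp
  define n where "n = length W"
  have jn: "j < n" using j n_def by simp
  have "(\<Sum>s<n. V ! s * W ! ((j + n - s) mod n)) = (\<Sum>s<n. W ! s * V ! ((j + n - s) mod n))"
    by (rule sum.reindex_bij_witness[of _ "\<lambda>s. (j + n - s) mod n" "\<lambda>s. (j + n - s) mod n"])
       (use jn in \<open>auto simp: mod_reflect_nat mult.commute\<close>)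
  then show "(V \<boxtimes> W) ! j = (W \<boxtimes> V) ! j"
    using j assms by (simp add: nth_convolution n_def)
qed (use assms in simp)

text \<open>Translation by \<open>s\<close> permutes the residues modulo \<open>n\<close>;
  associativity uses this to shift its inner index.\<close>

lemma sum_rotate:
  fixes f :: "nat \<Rightarrow> 'a::comm_monoid_add"
  assumes "s < n"
  shows "(\<Sum>k<n. f k) = (\<Sum>t<n. f ((t + s) mod n))"
proof (rule sum.reindex_bij_witness[of _ "\<lambda>t. (t + s) mod n" "\<lambda>k. (k + n - s) mod n"])
  fix k assume "k \<in> {..<n}"
  then have "((k + n - s) mod n + s) mod n = k"
    using assms by (simp add: mod_add_left_eq)
  then show "((k + n - s) mod n + s) mod n = k" "f (((k + n - s) mod n + s) mod n) = f k"
    by simp_all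
next
  fix t assume "t \<in> {..<n}"
  then show "((t + s) mod n + n - s) mod n = t"
    using assms by (simp add: mod_diff_mod_nat)
qed (use assms in auto)

lemma convolution_assoc:
  assumes "length V = length U" "length W = length U"
  shows "(U \<boxtimes> V) \<boxtimes> W = U \<boxtimes> (V \<boxtimes> W)"
proof (rule nth_equalityI)
  fix j assume "j < length ((U \<boxtimes> V) \<boxtimes> W)"
  define n where "n = length U"
  have j: "j < n" and n: "length U = n" "length V = n" "length W = n"
    using \<open>j < _\<close> assms by (simp_all add: n_def)
  \<comment> \<open>For fixed \<open>s\<close>, substituting k = t + s turns the part depending on
    \<open>k\<close> into an entry of \<open>V \<boxtimes> W\<close>; swapping the two sums then
    gives associativity.\<close>
  have inner: "(\<Sum>k<n. V ! ((k + n - s) mod n) * W ! ((j + n - k) mod n))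
      = (V \<boxtimes> W) ! ((j + n - s) mod n)" if s: "s < n" for s
  proof -
    have "(\<Sum>k<n. V ! ((k + n - s) mod n) * W ! ((j + n - k) mod n))
        = (\<Sum>t<n. V ! (((t + s) mod n + n - s) mod n) * W ! ((j + n - (t + s) mod n) mod n))"
      by (rule sum_rotate[OF s])
    also have "\<dots> = (\<Sum>t<n. V ! t * W ! (((j + n - s) mod n + n - t) mod n))"
    proof (rule sum.cong[OF refl])
      fix t assume "t \<in> {..<n}"
      then have t: "t < n" by simp
      \<comment> \<open>Both sides represent j - s - t modulo \<open>n\<close>; the cases are
        whether t + s wraps around.\<close>
      have "(j + n - (t + s) mod n) mod n = (j + n - s + n - t) mod n"
      proof (cases "t + s < n")
        case True
        have "j + n - s + n - t = (j + n - (t + s)) + n"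
          using True s t by simp
        then show ?thesis using True by (metis mod_add_self2 mod_less)
      next
        case False
        then have "(t + s) mod n = t + s - n" using s t by (simp add: mod_if)
        then show ?thesis using False s t by (simp add: algebra_simps)
      qed
      then show "V ! (((t + s) mod n + n - s) mod n) * W ! ((j + n - (t + s) mod n) mod n)
          = V ! t * W ! (((j + n - s) mod n + n - t) mod n)"
        using s t by (simp add: mod_diff_mod_nat)
    qed
    finally show ?thesis using s j n by (simp add: nth_convolution)
  qed
  have "((U \<boxtimes> V) \<boxtimes> W) ! j
      = (\<Sum>k<n. \<Sum>s<n. U ! s * (V ! ((k + n - s) mod n) * W ! ((j + n - k) mod n)))"
    using j n by (simp add: nth_convolution sum_distrib_right mult.assoc)
  also have "\<dots> = (\<Sum>s<n. U ! s * (\<Sum>k<n. V ! ((k + n - s) mod n) * W ! ((j + n - k) mod n)))"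
    by (subst sum.swap) (simp add: sum_distrib_left)
  also have "\<dots> = (U \<boxtimes> (V \<boxtimes> W)) ! j"
    using j n inner by (simp add: nth_convolution)
  finally show "((U \<boxtimes> V) \<boxtimes> W) ! j = (U \<boxtimes> (V \<boxtimes> W)) ! j" .
qed simp

lemma identity_convolution:
  assumes "length W = n"
  shows "identity_string n \<boxtimes> W = W"
proof (rule nth_equalityI)
  fix j assume "j < length (identity_string n \<boxtimes> W)"
  then have j: "j < n" by (simp add: identity_string_def)
  have "(identity_string n \<boxtimes> W) ! j = (\<Sum>s<n. identity_string n ! s * W ! ((j + n - s) mod n))"
    using j by (simp add: nth_convolution identity_string_def)
  also have "\<dots> = (\<Sum>s<n. if s = 0 then W ! ((j + n - s) mod n) else 0)"
    by (rule sum.cong) (auto simp: identity_string_def)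
  also have "\<dots> = W ! ((j + n - 0) mod n)"
    using j by (subst sum.delta) auto
  finally show "(identity_string n \<boxtimes> W) ! j = W ! j"
    using j by simp
qed (use assms in \<open>simp add: identity_string_def\<close>)

lemma convolution_zero: "V \<boxtimes> replicate (length V) 0 = replicate (length V) 0"
proof (rule nth_equalityI)
  fix j assume "j < length (V \<boxtimes> replicate (length V) 0)"
  then have j: "j < length V" by simp
  \<comment> \<open>Every index read is in range, so \<open>replicate\<close> yields 0 and not an
    unspecified entry.\<close>
  then have "(j + length V - s) mod length V < length V" for s
    by (intro mod_less_divisor) linarith
  then show "(V \<boxtimes> replicate (length V) 0) ! j = replicate (length V) 0 ! j"
    using j by (simp add: nth_convolution)
qed simp

text \<open>Convolution with \<open>V\<close> is a linear endomap of a finite space, so it is onto as soon as its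
  kernel is trivial.\<close>

lemma irreversible_iff_kernel:
  "irreversible V \<longleftrightarrow>
    (\<exists>W. length W = length V \<and> W \<noteq> replicate (length V) 0 \<and> V \<boxtimes> W = replicate (length V) 0)"
    (is "_ \<longleftrightarrow> ?kernel")
proof
  define n where "n = length V"
  define L where "L = {W :: bit list. length W = n}"
  assume irrev: "irreversible V"
  show ?kernel
  proof (rule ccontr)
    assume no_kernel: "\<not> ?kernel"
    have "inj_on (\<lambda>W. V \<boxtimes> W) L"
    proof (rule inj_onI)
      fix W W' assume WL: "W \<in> L" "W' \<in> L" and eq: "V \<boxtimes> W = V \<boxtimes> W'"
      \<comment> \<open>By linearity the difference of two strings with equal images lies in the
        kernel.\<close>
      define D where "D = map (\<lambda>i. W ! i - W' ! i) [0..<n]"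
      have "V \<boxtimes> D = replicate n 0"
      proof (rule nth_equalityI)
        fix j assume "j < length (V \<boxtimes> D)"
        then have j: "j < n" by (simp add: n_def)
        have "(V \<boxtimes> D) ! j
            = (\<Sum>s<n. V ! s * W ! ((j + n - s) mod n) - V ! s * W' ! ((j + n - s) mod n))"
          using j by (auto simp: nth_convolution D_def n_def[symmetric] right_diff_distrib
              intro!: sum.cong)
        also have "\<dots> = (V \<boxtimes> W) ! j - (V \<boxtimes> W') ! j"
          using j by (simp add: nth_convolution n_def[symmetric] sum_subtractf)
        also have "\<dots> = 0" using eq by simp
        finally show "(V \<boxtimes> D) ! j = replicate n 0 ! j" using j by simp
      qed (simp add: n_def)
      then have D0: "D = replicate n 0"
        using no_kernel by (metis D_def diff_zero length_map length_upt n_def)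
      have "W ! i = W' ! i" if "i < n" for i
      proof -
        have "W ! i - W' ! i = D ! i" using that by (simp add: D_def)
        also have "\<dots> = 0" using that by (simp add: D0)
        finally show ?thesis by simp
      qed
      then show "W = W'"
        using WL by (intro nth_equalityI) (auto simp: L_def)
    qed
    moreover have "finite L"
    proof -
      have "finite (UNIV :: bit set)" by (simp add: UNIV_bit)
      then show ?thesis
        using finite_lists_length_eq[of "UNIV :: bit set" n] by (simp add: L_def)
    qed
    moreover have "(\<lambda>W. V \<boxtimes> W) ` L \<subseteq> L" by (auto simp: L_def n_def)
    ultimately have "(\<lambda>W. V \<boxtimes> W) ` L = L" by (simp add: endo_inj_surj)
    moreover have "identity_string n \<in> L" by (simp add: L_def identity_string_def)
    \<comment> \<open>A preimage of the identity is a right inverse; commutativity makes it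
      two-sided.\<close>
    ultimately obtain W where "W \<in> L" "V \<boxtimes> W = identity_string n" by (metis imageE)
    then have "reversible V"
      unfolding reversible_def
      by (metis L_def convolution_commute mem_Collect_eq n_def)
    with irrev show False by simp
  qed
next
  assume ?kernel
  then obtain W where W: "length W = length V" "W \<noteq> replicate (length V) 0"
    "V \<boxtimes> W = replicate (length V) 0" by blast
  show "irreversible V"
  proof
    assume "reversible V"
    then obtain U where U: "length U = length V" "U \<boxtimes> V = identity_string (length V)"
      unfolding reversible_def by blast
    \<comment> \<open>Cancelling \<open>V\<close> by its inverse \<open>U\<close> forces the kernel
      element to be zero.\<close>
    have "W = (U \<boxtimes> V) \<boxtimes> W" using W U by (simp add: identity_convolution)
    also have "\<dots> = U \<boxtimes> (V \<boxtimes> W)" using W(1) U(1) by (intro convolution_assoc) simp_all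
    also have "\<dots> = replicate (length V) 0" using W U by (metis convolution_zero)
    finally show False using W by simp
  qed
qed

section \<open>Solutions of the recursion\<close>

lemma positions_bounds:
  assumes "positions C" "x \<in> set C"
  shows "hd C \<le> x" "x \<le> last C"
proof -
  have "C \<noteq> []" "sorted C"
    using assms by (auto simp: positions_def strict_sorted_iff)
  obtain i where i: "i < length C" "x = C ! i" using assms by (metis in_set_conv_nth)
  show "hd C \<le> x" using i \<open>C \<noteq> []\<close> \<open>sorted C\<close> by (simp add: hd_conv_nth sorted_nth_mono)
  show "x \<le> last C" using i \<open>C \<noteq> []\<close> \<open>sorted C\<close> by (simp add: last_conv_nth sorted_nth_mono)
qed

text \<open>In characteristic 2 the left-hand side of the recursion is the missing summand \<open>l = 1\<close>;
  the index is moved by $\delta$ so that no truncated subtraction remains.\<close>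

lemma solution_iff:
  assumes "positions C"
  shows "solution C T \<longleftrightarrow> (\<forall>i. (\<Sum>x\<in>set C. T (i + (last C - x))) = 0)"
proof -
  define \<delta> where "\<delta> = last C - hd C"
  have C: "C \<noteq> []" "distinct C" using assms by (auto simp: positions_def strict_sorted_iff)
  have eq: "(\<Sum>x\<in>set C. T (i + (last C - x)))
      = T (i + \<delta>) + (\<Sum>l = 2..length C. T (i + \<delta> - (C ! (l - 1) - hd C)))" for i
  proof -
    have idx: "i + (last C - x) = i + \<delta> - (x - hd C)" if "x \<in> set C" for x
      using positions_bounds[OF assms that] by (simp add: \<delta>_def)
    have "(\<Sum>x\<in>set C. T (i + (last C - x))) = (\<Sum>x\<in>set C. T (i + \<delta> - (x - hd C)))"
      using idx by simp
    also have "\<dots> = (\<Sum>k<length C. T (i + \<delta> - (C ! k - hd C)))"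
      using sum.reindex_bij_betw[OF bij_betw_nth[OF C(2) refl refl], symmetric] by simp
    also have "\<dots> = (\<Sum>l = 1..length C. T (i + \<delta> - (C ! (l - 1) - hd C)))"
      by (rule sum.reindex_bij_witness[of _ "\<lambda>l. l - 1" Suc]) auto
    also have "\<dots> = T (i + \<delta>) + (\<Sum>l = 2..length C. T (i + \<delta> - (C ! (l - 1) - hd C)))"
      using C by (subst sum.atLeast_Suc_atMost) (auto simp: Suc_le_eq hd_conv_nth numeral_2_eq_2)
    finally show ?thesis .
  qed
  have char2: "a + b = 0 \<longleftrightarrow> a = b" for a b :: bit
    by (cases a; cases b) simp_all
  have "solution C T \<longleftrightarrow>
      (\<forall>i. T (i + \<delta>) = (\<Sum>l = 2..length C. T (i + \<delta> - (C ! (l - 1) - hd C))))"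
    unfolding solution_def \<delta>_def[symmetric] by (metis le_add2 le_add_diff_inverse2)
  then show ?thesis by (simp only: eq char2)
qed

lemma solution_shift:
  assumes "positions C" "solution C T"
  shows "solution C (\<lambda>t. T (t + d))"
  unfolding solution_iff[OF assms(1)]
proof
  fix i
  have "(\<Sum>x\<in>set C. T (i + d + (last C - x))) = 0"
    using assms by (simp add: solution_iff)
  then show "(\<Sum>x\<in>set C. T (i + (last C - x) + d)) = 0"
    by (simp add: ac_simps)
qed

lemma solution_diff:
  assumes "positions C" "solution C S" "solution C T"
  shows "solution C (\<lambda>t. S t - T t)"
  using assms by (simp add: solution_iff sum_subtractf)

text \<open>Both extreme coefficients of the recursion are 1, so it can be run in either direction.\<close>

lemma solution_window_zero:
  assumes "positions C" "solution C T" "\<And>k. k < last C - hd C \<Longrightarrow> T (i + k) = 0"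
  shows "T = (\<lambda>_. 0)"
proof -
  define \<delta> where "\<delta> = last C - hd C"
  have ne: "C \<noteq> []" using assms(1) by (simp add: positions_def)
  have rec: "(\<Sum>x\<in>set C. T (j + (last C - x))) = 0" for j
    using assms by (simp add: solution_iff)
  \<comment> \<open>Forward: the term for \<open>hd C\<close> has the largest index,
    \<open>i + k\<close>; all others lie in the range from \<open>i\<close> up to but excluding
    \<open>i + k\<close>, where \<open>T\<close> is already known to vanish.\<close>
  have fwd: "T (i + k) = 0" for k
  proof (induction k rule: less_induct)
    case (less k)
    show ?case
    proof (cases "k < \<delta>")
      case True
      then show ?thesis using assms(3) \<delta>_def by blast
    next
      case False
      define j where "j = i + (k - \<delta>)"
      have "T (j + (last C - x)) = 0" if "x \<in> set C - {hd C}" for x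
      proof -
        have "hd C < x" "x \<le> last C"
          using that positions_bounds[OF assms(1), of x] by auto
        then have "j + (last C - x) = i + (k - (x - hd C))" "k - (x - hd C) < k"
          using False by (auto simp: j_def \<delta>_def)
        then show ?thesis using less.IH by metis
      qed
      then have "(\<Sum>x\<in>set C. T (j + (last C - x))) = T (j + (last C - hd C))"
        using ne by (subst sum.remove[of _ "hd C"]) (auto intro!: sum.neutral)
      moreover have "j + (last C - hd C) = i + k"
        using False by (simp add: j_def \<delta>_def)
      ultimately show ?thesis using rec[of j] by simp
    qed
  qed
  \<comment> \<open>Backward: the term for \<open>last C\<close> has the smallest index, so its
    value is forced by later ones. Once \<open>m\<close> reaches \<open>i\<close>, truncation keeps
    \<open>j\<close> at 0 and the step proves \<open>T 0 = 0\<close> again.\<close>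
  have bwd: "\<forall>t\<ge>i - m. T t = 0" for m
  proof (induction m)
    case 0
    then show ?case using fwd by (metis diff_zero le_Suc_ex)
  next
    case (Suc m)
    define j where "j = i - Suc m"
    have zero: "T t = 0" if "t > j" for t
      using Suc that by (simp add: j_def)
    have "T (j + (last C - x)) = 0" if "x \<in> set C - {last C}" for x
      using that positions_bounds[OF assms(1), of x] by (intro zero) auto
    then have "(\<Sum>x\<in>set C. T (j + (last C - x))) = T j"
      using ne by (subst sum.remove[of _ "last C"]) (auto intro!: sum.neutral)
    then have "T j = 0" using rec[of j] by simp
    then show ?case using zero j_def by (metis le_neq_implies_less)
  qed
  show ?thesis using bwd[of i] by (auto simp: fun_eq_iff)
qed

text \<open>The difference of \<open>T\<close> and its shift by \<open>d\<close> is again a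
  solution, so vanishing on one window makes it vanish everywhere, also before the window. This is
  what removes pre-periods.\<close>

lemma solution_periodic_of_window:
  assumes "positions C" "solution C T"
    and "\<And>k. k < last C - hd C \<Longrightarrow> T (i + k + d) = T (i + k)"
  shows "T (t + d) = T t"
proof -
  have "solution C (\<lambda>t. T (t + d) - T t)"
    using assms by (intro solution_diff solution_shift)
  then have "(\<lambda>t. T (t + d) - T t) = (\<lambda>_. 0)"
    by (rule solution_window_zero[OF assms(1), of _ i]) (simp add: assms(3))
  then have "T (t + d) - T t = 0" by (rule fun_cong)
  then show ?thesis by simp
qed

lemma periodic_mult:
  fixes T :: "nat \<Rightarrow> 'a"
  assumes "\<And>t. T (t + n) = T t"
  shows "T (t + k * n) = T t"
  by (induction k) (simp_all add: assms add.assoc[symmetric] add.commute[of n])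

lemma periodic_mod:
  fixes T :: "nat \<Rightarrow> 'a"
  assumes "\<And>t. T (t + n) = T t"
  shows "T (t mod n) = T t"
  using periodic_mult[of T n "t mod n" "t div n"] assms by simp

text \<open>A solution has no genuine pre-period.\<close>

lemma ex_period_iff:
  assumes "positions C" "solution C T" "n > 0"
  shows "(\<exists>p. is_period p T \<and> length p dvd n) \<longleftrightarrow> (\<forall>t. T (t + n) = T t)"
proof
  assume "\<exists>p. is_period p T \<and> length p dvd n"
  then obtain p \<rho> where dvd: "length p dvd n"
    and T: "\<And>i. T i = (if i < length \<rho> then \<rho> ! i else p ! ((i - length \<rho>) mod length p))"
    unfolding is_period_def by blast
  obtain k where k: "n = length p * k" using dvd by blast
  \<comment> \<open>Past \<rho>, adding \<open>n\<close> skips whole copies of \<open>p\<close>; the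
    window starting at \<open>length \<rho>\<close> then suffices.\<close>
  have "T (length \<rho> + j + n) = T (length \<rho> + j)" for j
    by (simp add: T k)
  then show "\<forall>t. T (t + n) = T t"
    using solution_periodic_of_window[OF assms(1,2)] by blast
next
  assume per: "\<forall>t. T (t + n) = T t"
  \<comment> \<open>With empty pre-period, the first \<open>n\<close> symbols form a period of
    length \<open>n\<close> itself.\<close>
  have "is_period (map T [0..<n]) T"
    unfolding is_period_def
    using assms(3) periodic_mod[of T n] per by (auto intro!: exI[of _ "[]"])
  then show "\<exists>p. is_period p T \<and> length p dvd n"
    by (intro exI[of _ "map T [0..<n]"]) simp
qed

section \<open>Kernel elements and periodic solutions\<close>

lemma nth_string_of_positions_convolution:
  assumes "positions C" "n > last C" "j < n"
  shows "(string_of_positions C n \<boxtimes> W) ! j = (\<Sum>x\<in>set C. W ! ((j + n - x) mod n))"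
proof -
  have sub: "set C \<subseteq> {..<n}"
    using positions_bounds(2)[OF assms(1)] assms(2) by fastforce
  have "(string_of_positions C n \<boxtimes> W) ! j
      = (\<Sum>s<n. if s \<in> set C then W ! ((j + n - s) mod n) else 0)"
    using assms(3)
    by (auto simp: nth_convolution string_of_positions_def intro!: sum.cong)
  also have "\<dots> = (\<Sum>x\<in>set C. W ! ((j + n - x) mod n))"
    using sub by (simp add: sum.If_cases Int_absorb1)
  finally show ?thesis .
qed

text \<open>Entry \<open>j\<close> of the convolution is the recursion sum at any i congruent to j -
  \<open>last C\<close> modulo \<open>n\<close>. For periodic \<open>T\<close>, the \<open>n\<close>
  cyclic equations are therefore equivalent to all recursion equations.\<close>

lemma string_convolution_eq_0_iff:
  assumes "positions C" "n > last C" "\<And>t. T (t + n) = T t"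
  shows "string_of_positions C n \<boxtimes> map T [0..<n] = replicate n 0 \<longleftrightarrow> solution C T"
proof -
  define V where "V = string_of_positions C n"
  have len: "length V = n" by (simp add: V_def string_of_positions_def)
  have n: "n > 0" using assms(2) by simp
  have xn: "x \<le> last C" "x < n" if "x \<in> set C" for x
    using positions_bounds[OF assms(1) that] assms(2) by auto
  have per: "T (t mod n) = T t" for t by (rule periodic_mod) (rule assms(3))
  have conv: "(V \<boxtimes> map T [0..<n]) ! j = (\<Sum>x\<in>set C. T (j + n - x))" if "j < n" for j
    using that n by (simp add: V_def nth_string_of_positions_convolution[OF assms(1,2)] per)
  have "V \<boxtimes> map T [0..<n] = replicate n 0 \<longleftrightarrow> (\<forall>j<n. (\<Sum>x\<in>set C. T (j + n - x)) = 0)"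
    using conv by (auto simp: list_eq_iff_nth_eq len)
  also have "\<dots> \<longleftrightarrow> (\<forall>i. (\<Sum>x\<in>set C. T (i + (last C - x))) = 0)"
  proof (intro iffI allI impI)
    fix i assume *: "\<forall>j<n. (\<Sum>x\<in>set C. T (j + n - x)) = 0"
    \<comment> \<open>The recursion equation at \<open>i\<close> is the cyclic one at
      \<open>(i + last C) mod n\<close>.\<close>
    have "T (i + (last C - x)) = T ((i + last C) mod n + n - x)" if "x \<in> set C" for x
    proof -
      have "T ((i + last C) mod n + n - x) = T (i + last C + n - x)"
        using mod_diff_mod_nat[of x n "i + last C"] xn[OF that] per by (metis less_imp_le)
      also have "i + last C + n - x = i + (last C - x) + n" using xn[OF that] by simp
      finally show ?thesis using assms(3) by simp
    qed
    then have "(\<Sum>x\<in>set C. T (i + (last C - x))) = (\<Sum>x\<in>set C. T ((i + last C) mod n + n - x))"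
      by simp
    then show "(\<Sum>x\<in>set C. T (i + (last C - x))) = 0" using * n by simp
  next
    fix j assume *: "\<forall>i. (\<Sum>x\<in>set C. T (i + (last C - x))) = 0" and "j < n"
    \<comment> \<open>Conversely the cyclic equation at \<open>j\<close> is the recursion at
      \<open>j + n - last C\<close>, where \<open>n > last C\<close> prevents truncation.\<close>
    have "j + n - x = (j + n - last C) + (last C - x)" if "x \<in> set C" for x
      using xn[OF that] assms(2) by simp
    then have "(\<Sum>x\<in>set C. T (j + n - x)) = (\<Sum>x\<in>set C. T ((j + n - last C) + (last C - x)))"
      by (intro sum.cong) auto
    then show "(\<Sum>x\<in>set C. T (j + n - x)) = 0" using * by simp
  qed
  finally show ?thesis using assms(1) by (simp add: solution_iff V_def)
qed

lemma irreversible_iff_periodic_solution: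
  assumes "positions C" "n > last C"
  shows "irreversible (string_of_positions C n) \<longleftrightarrow>
    (\<exists>T. solution C T \<and> T \<noteq> (\<lambda>_. 0) \<and> (\<forall>t. T (t + n) = T t))"
proof
  have len: "length (string_of_positions C n) = n" by (simp add: string_of_positions_def)
  have n: "n > 0" using assms(2) by simp
  {
    assume "irreversible (string_of_positions C n)"
    then obtain W where W: "length W = n" "W \<noteq> replicate n 0"
      "string_of_positions C n \<boxtimes> W = replicate n 0"
      by (auto simp: irreversible_iff_kernel len)
    define T where "T t = W ! (t mod n)" for t
    have WT: "W = map T [0..<n]"
      using W by (intro nth_equalityI) (auto simp: T_def)
    have per: "T (t + n) = T t" for t by (simp add: T_def)
    have "solution C T"
      using string_convolution_eq_0_iff[OF assms, of T] per W(3) WT by simp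
    moreover have "T \<noteq> (\<lambda>_. 0)"
      using W(2) WT by (auto simp: map_replicate_const)
    ultimately show "\<exists>T. solution C T \<and> T \<noteq> (\<lambda>_. 0) \<and> (\<forall>t. T (t + n) = T t)"
      using per by blast
  next
    assume "\<exists>T. solution C T \<and> T \<noteq> (\<lambda>_. 0) \<and> (\<forall>t. T (t + n) = T t)"
    then obtain T where T: "solution C T" "T \<noteq> (\<lambda>_. 0)" and per: "\<And>t. T (t + n) = T t"
      by blast
    \<comment> \<open>A non-zero \<open>n\<close>-periodic sequence has a non-zero symbol among its
      first \<open>n\<close>.\<close>
    have "map T [0..<n] \<noteq> replicate n 0"
    proof
      assume eq: "map T [0..<n] = replicate n 0"
      have "T t = 0" for t
      proof -
        have "T (t mod n) = 0"
          using arg_cong[OF eq, of "\<lambda>xs. xs ! (t mod n)"] n by simp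
        then show ?thesis using periodic_mod[of T n t] per by simp
      qed
      then show False using T(2) by auto
    qed
    moreover have "string_of_positions C n \<boxtimes> map T [0..<n] = replicate n 0"
      using string_convolution_eq_0_iff[OF assms, of T] per T by simp
    ultimately show "irreversible (string_of_positions C n)"
      unfolding irreversible_iff_kernel len by (intro exI[of _ "map T [0..<n]"]) simp
  }
qed

text \<open>Each recursion equation becomes a sum of r ones, which is 0 modulo 2. The sequence is
  \<open>n\<close>-periodic for every \<open>n\<close>, as part (iv) requires.\<close>

lemma solution_const_1:
  assumes "positions C" "even (length C)"
  shows "solution C (\<lambda>_. 1)"
proof -
  have "card (set C) = length C"
    using assms(1) by (simp add: positions_def strict_sorted_iff distinct_card)
  moreover have "of_nat (length C) = (0 :: bit)" using assms(2) by (auto elim!: evenE)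
  ultimately show ?thesis using assms(1) by (simp add: solution_iff)
qed

theorem theorem1:
  fixes C :: "nat list"
  assumes "positions C"
  shows "(\<forall>n > last C. irreversible (string_of_positions C n) \<longleftrightarrow>
           (\<exists>T p. solution C T \<and> T \<noteq> (\<lambda>_. 0) \<and> is_period p T \<and> length p dvd n))
    \<and> (\<forall>n > last C. irreversible (string_of_positions C n) \<longrightarrow>
           (\<exists>d::nat. 0 < d \<and> d \<le> 2 ^ (last C - hd C) - 1 \<and> d dvd n))
    \<and> (length C = 1 \<longrightarrow> (\<forall>n > last C. reversible (string_of_positions C n)))
    \<and> (even (length C) \<longrightarrow> (\<forall>n > last C. irreversible (string_of_positions C n)))"
proof -
  have i: "irreversible (string_of_positions C n) \<longleftrightarrow>
      (\<exists>T p. solution C T \<and> T \<noteq> (\<lambda>_. 0) \<and> is_period p T \<and> length p dvd n)"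
    if "n > last C" for n
  proof -
    have "n > 0" using that by simp
    then show ?thesis
      using irreversible_iff_periodic_solution[OF assms that] ex_period_iff[OF assms] by blast
  qed
  have ii: "\<exists>d::nat. 0 < d \<and> d \<le> 2 ^ (last C - hd C) - 1 \<and> d dvd n"
    if n: "n > last C" and irrev: "irreversible (string_of_positions C n)" for n
  proof -
    obtain T where T: "solution C T" "T \<noteq> (\<lambda>_. 0)"
      using irreversible_iff_periodic_solution[OF assms n] irrev by blast
    \<comment> \<open>If \<delta> = 0, the window is empty, so the vanishing condition holds
      vacuously and only the zero solution exists.\<close>
    have "last C - hd C \<noteq> 0"
    proof
      assume "last C - hd C = 0"
      then have "T = (\<lambda>_. 0)" by (intro solution_window_zero[OF assms T(1)]) simp
      with T(2) show False by simp
    qed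
    then have "(2::nat) ^ 1 \<le> 2 ^ (last C - hd C)" by (intro power_increasing) simp_all
    \<comment> \<open>The bound only excludes $\delta = 0$: otherwise \<open>d = 1\<close> is admissible.\<close>
    then show ?thesis by (intro exI[of _ 1]) simp
  qed
  have iii: "reversible (string_of_positions C n)" if "length C = 1" "n > last C" for n
  proof -
    \<comment> \<open>Now the bound in \<open>ii\<close> is \<open>2 ^ 0 - 1 = 0\<close>, which no
      positive \<open>d\<close> meets, so irreversibility is impossible.\<close>
    have "last C = hd C" using that(1) by (auto simp: length_Suc_conv)
    then show ?thesis using ii[OF that(2)] by auto
  qed
  have iv: "irreversible (string_of_positions C n)" if "even (length C)" "n > last C" for n
    using irreversible_iff_periodic_solution[OF assms that(2)] solution_const_1[OF assms that(1)]
    by (metis zero_neq_one)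
  show ?thesis using i ii iii iv by blast
qed

end
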